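(* Let $X$ be a real vector space, $Y\subset X$ a vector subspace of $X$, $F$ a Dedekind complete Riesz space, $S:Y\to F$ a sublinear operator on $Y$, and $p: X\to F$ a sublinear operator on $X$ such that $S(u)\le p(u)$ for all $u\in Y$. Then there exists $T:X\to F$ such that $T(y)=S(y)$ for all $y\in Y$, $T$ is sublinear on $X$, and $T(x)\le p(x)$ for all $x\in X$.
   Context: A Riesz space (vector lattice) is a real ordered vector space in which every pair of elements has a supremum and an infimum. It is Dedekind complete if every nonempty subset that is bounded above has a supremum. A mapping $T$ from a real vector space $V$ to an ordered vector space $F$ is called sublinear if $T(x+y)\le T(x)+T(y)$ and $T(\lambda x)=\lambda T(x)$ for all $x,y\in V$ and all real $\lambda\ge 0$. *)

theory Defs
  imports Complex_Main
begin

text \<open>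
  Dedekind complete Riesz spaces are the types of sort
  \<open>{ordered_real_vector, conditionally_complete_lattice}\<close>. The second class also asks for
  infima of nonempty sets that are bounded below; in an ordered vector space these are
  the negatives of suprema, so this is no further restriction.
\<close>

definition sublinear_on :: "'a::real_vector set \<Rightarrow> ('a \<Rightarrow> 'b::ordered_real_vector) \<Rightarrow> bool" where
  "sublinear_on V T \<longleftrightarrow>
     (\<forall>x\<in>V. \<forall>y\<in>V. T (x + y) \<le> T x + T y) \<and>
     (\<forall>x\<in>V. \<forall>c::real. c \<ge> 0 \<longrightarrow> T (c *\<^sub>R x) = c *\<^sub>R T x)"

end

theory Submission
  imports Defs
begin

text \<open>
  The extension is the infimal convolution of \<open>S\<close> and \<open>p\<close>,
  \<open>T x = (INF y\<in>Y. S y + p (x - y))\<close>. Any sublinear operator that extends \<open>S\<close> and lies below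
  \<open>p\<close> satisfies \<open>T x \<le> T y + T (x - y) \<le> S y + p (x - y)\<close> for every
  \<open>y \<in> Y\<close>, so this is the largest candidate.

  The infimum exists because the domination \<open>S \<le> p\<close> on \<open>Y\<close> yields the uniform lower bound
  \<open>- p (- x)\<close>. On \<open>Y\<close> the infimum is attained at \<open>y = x\<close>; the choice \<open>y = 0\<close> gives \<open>T \<le> p\<close>; and
  sublinearity is inherited from \<open>S\<close> and \<open>p\<close> since sums and positive multiples of the
  competitors \<open>y\<close> are again competitors.
\<close>

definition inf_convolution ::
  "'a::real_vector set \<Rightarrow> ('a \<Rightarrow> 'f) \<Rightarrow> ('a \<Rightarrow> 'f) \<Rightarrow> 'a
    \<Rightarrow> 'f::{ordered_real_vector, conditionally_complete_lattice}" where
  "inf_convolution Y S p x = (INF y\<in>Y. S y + p (x - y))"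

lemma sublinear_on_add:
  "sublinear_on V T \<Longrightarrow> x \<in> V \<Longrightarrow> y \<in> V \<Longrightarrow> T (x + y) \<le> T x + T y"
  by (simp add: sublinear_on_def)

lemma sublinear_on_scaleR:
  "sublinear_on V T \<Longrightarrow> x \<in> V \<Longrightarrow> c \<ge> 0 \<Longrightarrow> T (c *\<^sub>R x) = c *\<^sub>R T x"
  by (simp add: sublinear_on_def)

lemma sublinear_on_zero:
  assumes "sublinear_on V T" "0 \<in> V"
  shows "T 0 = 0"
  using sublinear_on_scaleR[OF assms, of 0] by simp

context
  fixes Y :: "'a::real_vector set"
    and S p :: "'a \<Rightarrow> 'f::{ordered_real_vector, conditionally_complete_lattice}"
  assumes Y: "subspace Y"
    and S: "sublinear_on Y S"
    and p: "sublinear_on UNIV p"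
    and dominated: "\<And>u. u \<in> Y \<Longrightarrow> S u \<le> p u"
begin

text \<open>
  The dependence on \<open>y\<close> cancels: \<open>- S y \<le> S (- y) \<le> p (- y) \<le> p (x - y) + p (- x)\<close>.
\<close>

lemma competitor_lower_bound:
  assumes y: "y \<in> Y"
  shows "- p (- x) \<le> S y + p (x - y)"
proof -
  have "0 \<le> S y + S (- y)"
    using sublinear_on_add[OF S y subspace_neg[OF Y y]]
      sublinear_on_zero[OF S subspace_0[OF Y]] by simp
  also have "S (- y) \<le> p (- y)"
    by (rule dominated[OF subspace_neg[OF Y y]])
  also have "p (- y) \<le> p (x - y) + p (- x)"
    using sublinear_on_add[OF p, of "x - y" "- x"] by simp
  finally have "0 \<le> (S y + p (x - y)) + p (- x)"
    by (simp add: add.assoc)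
  then show ?thesis
    using add_right_mono[of 0 "(S y + p (x - y)) + p (- x)" "- p (- x)"] by simp
qed

lemma inf_convolution_le:
  assumes "y \<in> Y"
  shows "inf_convolution Y S p x \<le> S y + p (x - y)"
  unfolding inf_convolution_def
proof (rule cINF_lower[OF _ assms])
  show "bdd_below ((\<lambda>y. S y + p (x - y)) ` Y)"
    using competitor_lower_bound by (intro bdd_belowI2)
qed

lemma inf_convolution_greatest:
  assumes "\<And>y. y \<in> Y \<Longrightarrow> z \<le> S y + p (x - y)"
  shows "z \<le> inf_convolution Y S p x"
  unfolding inf_convolution_def
  using subspace_0[OF Y] assms by (intro cINF_greatest) auto

lemma inf_convolution_le_right: "inf_convolution Y S p x \<le> p x"
  using inf_convolution_le[OF subspace_0[OF Y], of x]
    sublinear_on_zero[OF S subspace_0[OF Y]] by simp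

lemma inf_convolution_eq_left:
  assumes x: "x \<in> Y"
  shows "inf_convolution Y S p x = S x"
proof (rule order.antisym)
  show "inf_convolution Y S p x \<le> S x"
    using inf_convolution_le[OF x, of x] sublinear_on_zero[OF p UNIV_I] by simp
  show "S x \<le> inf_convolution Y S p x"
  proof (rule inf_convolution_greatest)
    fix y assume y: "y \<in> Y"
    have xy: "x - y \<in> Y"
      by (rule subspace_diff[OF Y x y])
    have "S x \<le> S y + S (x - y)"
      using sublinear_on_add[OF S y xy] by simp
    also have "\<dots> \<le> S y + p (x - y)"
      by (intro add_left_mono dominated xy)
    finally show "S x \<le> S y + p (x - y)" .
  qed
qed

lemma inf_convolution_add:
  "inf_convolution Y S p (x + x') \<le> inf_convolution Y S p x + inf_convolution Y S p x'"
proof -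
  let ?T = "inf_convolution Y S p"
  have competitors: "?T (x + x') \<le> (S y + p (x - y)) + (S y' + p (x' - y'))"
    if y: "y \<in> Y" and y': "y' \<in> Y" for y y'
  proof -
    have "?T (x + x') \<le> S (y + y') + p ((x - y) + (x' - y'))"
      using inf_convolution_le[OF subspace_add[OF Y y y'], of "x + x'"]
      by (simp add: algebra_simps)
    also have "\<dots> \<le> (S y + S y') + (p (x - y) + p (x' - y'))"
      using y y' by (intro add_mono sublinear_on_add[OF S] sublinear_on_add[OF p]) auto
    finally show ?thesis
      by (simp add: ac_simps)
  qed
  \<comment> \<open>The two infima are taken one after the other, with the other summand moved across.\<close>
  have "?T (x + x') - (S y' + p (x' - y')) \<le> ?T x" if "y' \<in> Y" for y'
    using competitors that by (intro inf_convolution_greatest) (simp add: diff_le_eq)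
  then have "?T (x + x') - ?T x \<le> ?T x'"
    by (intro inf_convolution_greatest) (simp add: diff_le_eq add.commute)
  then show ?thesis
    by (simp add: diff_le_eq add.commute)
qed

lemma inf_convolution_scaleR_le:
  assumes c: "c > 0"
  shows "inf_convolution Y S p (c *\<^sub>R x) \<le> c *\<^sub>R inf_convolution Y S p x"
proof -
  let ?T = "inf_convolution Y S p"
  have "inverse c *\<^sub>R ?T (c *\<^sub>R x) \<le> ?T x"
  proof (rule inf_convolution_greatest)
    fix y assume y: "y \<in> Y"
    have "?T (c *\<^sub>R x) \<le> S (c *\<^sub>R y) + p (c *\<^sub>R (x - y))"
      using inf_convolution_le[OF subspace_scale[OF Y y], of "c *\<^sub>R x" c]
      by (simp add: scaleR_diff_right)
    also have "\<dots> = c *\<^sub>R (S y + p (x - y))"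
      using c y by (simp add: sublinear_on_scaleR[OF S] sublinear_on_scaleR[OF p] scaleR_add_right)
    finally have "inverse c *\<^sub>R ?T (c *\<^sub>R x) \<le> inverse c *\<^sub>R (c *\<^sub>R (S y + p (x - y)))"
      using c by (intro scaleR_left_mono) auto
    then show "inverse c *\<^sub>R ?T (c *\<^sub>R x) \<le> S y + p (x - y)"
      using c by simp
  qed
  then have "c *\<^sub>R (inverse c *\<^sub>R ?T (c *\<^sub>R x)) \<le> c *\<^sub>R ?T x"
    using c by (intro scaleR_left_mono) auto
  then show ?thesis
    using c by simp
qed

text \<open>
  For \<open>c > 0\<close> the reverse inequality is the previous one for the factor \<open>inverse c\<close> at the point
  \<open>c *\<^sub>R x\<close>. For \<open>c = 0\<close> both sides vanish because \<open>0 \<in> Y\<close>, where the convolution agrees with \<open>S\<close>.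
\<close>

lemma inf_convolution_scaleR:
  assumes "c \<ge> 0"
  shows "inf_convolution Y S p (c *\<^sub>R x) = c *\<^sub>R inf_convolution Y S p x"
proof (cases "c = 0")
  case True
  then show ?thesis
    using inf_convolution_eq_left[OF subspace_0[OF Y]]
      sublinear_on_zero[OF S subspace_0[OF Y]] by simp
next
  case False
  let ?T = "inf_convolution Y S p"
  from False assms have c: "c > 0" by simp
  have "?T x \<le> inverse c *\<^sub>R ?T (c *\<^sub>R x)"
    using inf_convolution_scaleR_le[of "inverse c" "c *\<^sub>R x"] c by simp
  then have "c *\<^sub>R ?T x \<le> c *\<^sub>R (inverse c *\<^sub>R ?T (c *\<^sub>R x))"
    using c by (intro scaleR_left_mono) auto
  then have "c *\<^sub>R ?T x \<le> ?T (c *\<^sub>R x)"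
    using c by simp
  with inf_convolution_scaleR_le[OF c] show ?thesis
    by (rule order.antisym)
qed

lemma sublinear_inf_convolution: "sublinear_on UNIV (inf_convolution Y S p)"
  by (simp add: sublinear_on_def inf_convolution_add inf_convolution_scaleR)

end

theorem theorem3p3:
  fixes Y :: "'a::real_vector set"
    and S p :: "'a \<Rightarrow> 'f::{ordered_real_vector, conditionally_complete_lattice}"
  assumes "subspace Y"
    and "sublinear_on Y S"
    and "sublinear_on UNIV p"
    and "\<forall>u\<in>Y. S u \<le> p u"
  shows "\<exists>T :: 'a \<Rightarrow> 'f. (\<forall>y\<in>Y. T y = S y) \<and> sublinear_on UNIV T \<and> (\<forall>x. T x \<le> p x)"
proof (intro exI conjI ballI allI)
  let ?T = "inf_convolution Y S p"
  note hyps = assms(1-3) bspec[OF assms(4)]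
  show "?T y = S y" if "y \<in> Y" for y
    using hyps that by (rule inf_convolution_eq_left)
  show "sublinear_on UNIV ?T"
    using hyps by (rule sublinear_inf_convolution)
  show "?T x \<le> p x" for x
    using hyps by (rule inf_convolution_le_right)
qed

end
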